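(* Let $X$ be a reflexive Banach space such that $\|\cdot\|$ is a $\mathcal{C}^1$ functional on $X\setminus\{0\}$, and let $\Phi:X\to\mathbb{R}$ be a $\mathcal{C}^1$ functional such that $\Phi(0)=0$. In addition, assume that there exist $p,r>1$ such that: (1) $\displaystyle\liminf_{u\to 0}\frac{\Phi'(u)u}{\|u\|^r}>0$. (2) For every $u\in X$ we have $\Phi(u)\ge C_0\|u\|^r-I(u)$, where $C_0>0$ and $I$ is a weakly continuous functional on $X$. (3) $\displaystyle\lim_{t\to\infty}\frac{\Phi(tu)}{t^p}=-\infty$ uniformly for $u$ on weakly compact subsets of $X\setminus\{0\}$. (4) For every $u\in X\setminus\{0\}$ the maps $t\mapsto\frac{\Phi'(tu)u}{t^{p-1}}$ and $t\mapsto\Phi(tu)-\frac1p\Phi'(tu)tu$ are decreasing and increasing in $(0,\infty)$, respectively. (5) The maps $u\mapsto\Phi'(u)u$ and $u\mapsto\Phi(u)-\frac1p\Phi'(u)u$ are weakly lower semicontinuous on $X$. Let $\mathcal{N}=\{u\in X\setminus\{0\}:\ \Phi'(u)u=0\}$. Then $c:=\inf_{\mathcal{N}}\Phi$ is positive and achieved by some $u_0\neq 0$, i.e. $\Phi$ has a nontrivial ground state at a positive level. If, in addition, $\Phi$ is even, then we may choose $u_0\ge 0$.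
   Context: $\Phi'(u)v$ denotes the derivative of $\Phi$ at $u$ applied to $v$. A nontrivial ground state of $\Phi$ is a $u_0\neq0$ with $\Phi'(u_0)=0$ and $\Phi(u_0)=\min\{\Phi(u):\ u\neq0,\ \Phi'(u)=0\}$. "Increasing" and "decreasing" are meant strictly. A functional $I$ on $X$ is weakly continuous if $u_n\rightharpoonup u$ in $X$ implies $I(u_n)\to I(u)$. $\Phi$ is even if $\Phi(-u)=\Phi(u)$ for every $u\in X$. The inequality $u_0\ge0$ is the usual pointwise (a.e.) one when $X$ is a space of real-valued functions, such as a Sobolev space on a bounded domain.
   Formalization: Evenness alone does not give u_0 ≥ 0 (a quartic example on R^2 has only sign-changing ground states), so the last sentence is proved for a space X of real functions with the added assumption that |u| lies in X and Φ(|u|) ≤ Φ(u) for every u. *)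

theory Defs
  imports "HOL-Analysis.Analysis"
begin

definition reflexive_space :: "'a::real_normed_vector itself \<Rightarrow> bool" where
  "reflexive_space _ \<longleftrightarrow>
     (\<forall>\<xi> :: ('a \<Rightarrow>\<^sub>L real) \<Rightarrow>\<^sub>L real. \<exists>u::'a. \<forall>f. blinfun_apply \<xi> f = blinfun_apply f u)"

definition weak_topology :: "'a::real_normed_vector topology" where
  "weak_topology =
     topology_generated_by {blinfun_apply f -` U | (f :: 'a \<Rightarrow>\<^sub>L real) U. open U}"

abbreviation weakly_tendsto :: "(nat \<Rightarrow> 'a::real_normed_vector) \<Rightarrow> 'a \<Rightarrow> bool" where
  "weakly_tendsto u l \<equiv> limitin weak_topology u l sequentially"

lemma weakly_tendsto_iff:
  fixes u :: "nat \<Rightarrow> 'a::real_normed_vector"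
  shows "weakly_tendsto u l \<longleftrightarrow>
    (\<forall>f :: 'a \<Rightarrow>\<^sub>L real. (\<lambda>n. blinfun_apply f (u n)) \<longlonglongrightarrow> blinfun_apply f l)"
proof
  assume lim: "weakly_tendsto u l"
  show "\<forall>f :: 'a \<Rightarrow>\<^sub>L real. (\<lambda>n. blinfun_apply f (u n)) \<longlonglongrightarrow> blinfun_apply f l"
  proof (intro allI topological_tendstoI)
    fix f :: "'a \<Rightarrow>\<^sub>L real" and U :: "real set"
    assume U: "open U" and l: "blinfun_apply f l \<in> U"
    have "openin weak_topology (blinfun_apply f -` U)"
      unfolding weak_topology_def
      by (rule topology_generated_by_Basis, rule CollectI, rule exI, rule exI, rule conjI,
          rule refl, rule U)
    moreover have "l \<in> blinfun_apply f -` U"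
      using l by simp
    ultimately have "\<forall>\<^sub>F n in sequentially. u n \<in> blinfun_apply f -` U"
      using lim unfolding limitin_def by blast
    then show "\<forall>\<^sub>F n in sequentially. blinfun_apply f (u n) \<in> U"
      unfolding vimage_eq .
  qed
next
  let ?B = "{blinfun_apply f -` U | (f :: 'a \<Rightarrow>\<^sub>L real) U. open U}"
  assume lim: "\<forall>f :: 'a \<Rightarrow>\<^sub>L real. (\<lambda>n. blinfun_apply f (u n)) \<longlonglongrightarrow> blinfun_apply f l"
  have ev: "l \<in> V \<longrightarrow> (\<forall>\<^sub>F n in sequentially. u n \<in> V)"
    if "generate_topology_on ?B V" for V
    using that
  proof (induction rule: generate_topology_on.induct)
    case Empty
    show ?case by simp
  next
    case (Int a b)
    then show ?case by (simp add: eventually_conj_iff)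
  next
    case (UN K)
    show ?case
    proof
      assume "l \<in> \<Union>K"
      then obtain k where k: "k \<in> K" "l \<in> k" by blast
      then have "\<forall>\<^sub>F n in sequentially. u n \<in> k" using UN.IH by blast
      then show "\<forall>\<^sub>F n in sequentially. u n \<in> \<Union>K"
        by (rule eventually_mono) (use k in blast)
    qed
  next
    case (Basis s)
    then obtain f :: "'a \<Rightarrow>\<^sub>L real" and U where s: "s = blinfun_apply f -` U" "open U"
      by blast
    show ?case
      unfolding s(1) vimage_eq using topological_tendstoD[OF spec[OF lim] s(2)] by blast
  qed
  have "(UNIV :: 'a set) \<in> ?B"
    by (intro CollectI exI[of _ "0 :: 'a \<Rightarrow>\<^sub>L real"] exI[of _ "UNIV :: real set"]) simp
  then have "l \<in> topspace weak_topology"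
    unfolding weak_topology_def topology_generated_by_topspace by blast
  with ev show "weakly_tendsto u l"
    unfolding limitin_def weak_topology_def openin_topology_generated_by_iff by blast
qed

definition weakly_continuous :: "('a::real_normed_vector \<Rightarrow> real) \<Rightarrow> bool" where
  "weakly_continuous F \<longleftrightarrow> (\<forall>u l. weakly_tendsto u l \<longrightarrow> (\<lambda>n. F (u n)) \<longlonglongrightarrow> F l)"

text \<open>Sequential, in line with the sequential notion of weak continuity.\<close>

definition weakly_lsc :: "('a::real_normed_vector \<Rightarrow> real) \<Rightarrow> bool" where
  "weakly_lsc F \<longleftrightarrow>
     (\<forall>u l. weakly_tendsto u l \<longrightarrow> ereal (F l) \<le> liminf (\<lambda>n. ereal (F (u n))))"

text \<open>Intended for open \<open>S\<close>; \<open>f'\<close> is the Frechet derivative, continuous into the dual with the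
  operator norm.\<close>

definition C1_on :: "'a::real_normed_vector set \<Rightarrow> ('a \<Rightarrow> real) \<Rightarrow> ('a \<Rightarrow> 'a \<Rightarrow>\<^sub>L real) \<Rightarrow> bool" where
  "C1_on S f f' \<longleftrightarrow>
     (\<forall>u\<in>S. (f has_derivative blinfun_apply (f' u)) (at u)) \<and> continuous_on S f'"

definition nehari_set :: "('a::real_normed_vector \<Rightarrow> 'a \<Rightarrow>\<^sub>L real) \<Rightarrow> 'a set" where
  "nehari_set \<Phi>' = {u. u \<noteq> 0 \<and> blinfun_apply (\<Phi>' u) u = 0}"

text \<open>The infimum is taken in the extended reals, where it is meaningful without assuming that
  the Nehari set is nonempty or that the functional is bounded below on it.\<close>

definition nehari_level :: "('a::real_normed_vector \<Rightarrow> real) \<Rightarrow> ('a \<Rightarrow> 'a \<Rightarrow>\<^sub>L real) \<Rightarrow> ereal" where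
  "nehari_level \<Phi> \<Phi>' = (INF u\<in>nehari_set \<Phi>'. ereal (\<Phi> u))"

definition nontrivial_ground_state ::
  "('a::real_normed_vector \<Rightarrow> real) \<Rightarrow> ('a \<Rightarrow> 'a \<Rightarrow>\<^sub>L real) \<Rightarrow> 'a \<Rightarrow> bool" where
  "nontrivial_ground_state \<Phi> \<Phi>' u0 \<longleftrightarrow>
     u0 \<noteq> 0 \<and> \<Phi>' u0 = 0 \<and> (\<forall>u. u \<noteq> 0 \<and> \<Phi>' u = 0 \<longrightarrow> \<Phi> u0 \<le> \<Phi> u)"

text \<open>\<open>rep\<close> realizes the vector space as a space of real-valued measurable functions modulo
  a.e. equality: \<open>rep u\<close> is a representative of the class that \<open>u\<close> stands for.\<close>

definition function_space :: "'b measure \<Rightarrow> ('a::real_vector \<Rightarrow> 'b \<Rightarrow> real) \<Rightarrow> bool" where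
  "function_space M rep \<longleftrightarrow>
     (\<forall>u. rep u \<in> borel_measurable M) \<and>
     (\<forall>u v. AE x in M. rep (u + v) x = rep u x + rep v x) \<and>
     (\<forall>a u. AE x in M. rep (a *\<^sub>R u) x = a * rep u x) \<and>
     (\<forall>u. (AE x in M. rep u x = 0) \<longrightarrow> u = 0)"

text \<open>The modulus \<open>\<bar>u\<bar>\<close> of every element lies in the space and does not increase \<open>\<Phi>\<close>. For the
  usual even integral functionals on Sobolev spaces \<open>\<Phi> \<bar>u\<bar> = \<Phi> u\<close>. In general this does not
  follow from \<open>\<Phi> (- u) = \<Phi> u\<close>, and evenness alone does not yield a nonnegative ground state:
  for \<open>\<Phi> u = (u\<^sub>1\<^sup>2 + u\<^sub>2\<^sup>2) / 2 - ((u\<^sub>1 - u\<^sub>2)^4 + (u\<^sub>1^4 + u\<^sub>2^4) / 10) / 4\<close> on the functions on a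
  two-point set, the ground states are multiples of \<open>(1, -1)\<close>.\<close>

definition modulus_decreasing ::
  "'b measure \<Rightarrow> ('a \<Rightarrow> 'b \<Rightarrow> real) \<Rightarrow> ('a \<Rightarrow> real) \<Rightarrow> bool" where
  "modulus_decreasing M rep \<Phi> \<longleftrightarrow>
     (\<forall>u. \<exists>w. (AE x in M. rep w x = \<bar>rep u x\<bar>) \<and> \<Phi> w \<le> \<Phi> u)"

end

theory Submission imports Defs begin

text \<open>
  Fix \<open>u \<noteq> 0\<close> and look at the fibre \<open>t \<mapsto> \<Phi> (t u)\<close> on the half-line. It starts at \<open>0\<close>, increases
  at first by the behaviour of \<open>\<Phi>' u u\<close> near the origin, and tends to \<open>- \<infinity>\<close>. As its derivative divided by
  \<open>t powr (p - 1)\<close> is strictly decreasing, the derivative vanishes exactly once, at the maximum.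
  Thus every ray meets the Nehari set in exactly one point, \<open>\<Phi>\<close> is positive there, and minimising
  \<open>\<Phi>\<close> over the Nehari set is a minimax problem over rays.

  \<^bold>\<open>Compactness.\<close> Whenever \<open>v\<^sub>n\<close> tends weakly to \<open>0\<close> with norms bounded away from \<open>0\<close>, the coercivity
  \<open>\<Phi> u \<ge> C\<^sub>0 * norm u powr r - I u\<close> with \<open>I\<close> weakly continuous makes \<open>\<Phi>\<close> arbitrarily large on the
  rays through the \<open>v\<^sub>n\<close> (\<open>ray_energy_unbounded_if_weakly_null\<close>). Since \<open>\<Phi>\<close> on a ray is at most its
  value at the Nehari point, a minimising sequence can neither vanish weakly after
  normalisation nor vanish weakly itself. The first gives boundedness, as for an unbounded sequence
  a nonzero weak limit of the normalised one contradicts the uniform decay of \<open>\<Phi>\<close> on weakly compact sets; the second gives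
  a nonzero weak limit \<open>w\<close>. Lower semicontinuity of \<open>\<Phi>' u u\<close> puts the Nehari point of the ray of
  \<open>w\<close> at some \<open>t \<le> 1\<close>, and monotonicity and lower semicontinuity of \<open>\<Phi> u - \<Phi>' u u / p\<close>, which
  agrees with \<open>\<Phi>\<close> on the Nehari set, show that \<open>t w\<close> is a minimiser (\<open>nehari_minimum_attained\<close>).

  \<^bold>\<open>Criticality.\<close> If \<open>\<Phi>' u w < 0\<close> at a minimiser \<open>u\<close>, push \<open>u\<close> a little in the direction \<open>w\<close>. The Nehari
  point of the new ray lies near \<open>u\<close> by the intermediate value theorem, and its energy is smaller
  than that of a point on the old ray, hence smaller than \<open>\<Phi> u\<close>
  (\<open>nehari_minimizer_critical\<close>). Lagrange multipliers are out of place here: for a \<open>\<Phi>\<close> of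
  class \<open>C\<^sup>1\<close>, the constraint \<open>\<Phi>' u u = 0\<close> need not be differentiable. Nonzero critical points lie in the Nehari set, so a minimiser is a ground
  state.

  \<^bold>\<open>Weak sequential compactness.\<close> Bounded sequences in a reflexive space have weakly convergent
  subsequences (\<open>reflexive_weakly_convergent_subsequence\<close>). The proof rests on the Hahn--Banach theorem
  for sublinear functionals, applied on the dual space to \<open>f \<mapsto> limsup f (x n)\<close>: the linear functionals
  below it are, by reflexivity, the values at points \<open>u\<close> of the space, and these are candidates
  for the weak limit. After a diagonal argument there is only one candidate.
\<close>

section \<open>The Hahn--Banach theorem\<close>

text \<open>Only one inequality is required for positive scaling factors; applying it to the
  inverse factor gives the other (\<open>sublinear_scaleR\<close>).\<close>

definition sublinear :: "('a::real_vector \<Rightarrow> real) \<Rightarrow> bool" where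
  "sublinear q \<longleftrightarrow>
     (\<forall>x y. q (x + y) \<le> q x + q y) \<and> (\<forall>a>0. \<forall>x. q (a *\<^sub>R x) \<le> a * q x)"

lemma sublinearI:
  assumes "\<And>x y. q (x + y) \<le> q x + q y" "\<And>a x. a > 0 \<Longrightarrow> q (a *\<^sub>R x) \<le> a * q x"
  shows "sublinear q"
  using assms by (simp add: sublinear_def)

lemma sublinear_add: "sublinear q \<Longrightarrow> q (x + y) \<le> q x + q y"
  by (simp add: sublinear_def)

lemma sublinear_scaleR_le: "sublinear q \<Longrightarrow> a > 0 \<Longrightarrow> q (a *\<^sub>R x) \<le> a * q x"
  by (simp add: sublinear_def)

lemma sublinear_zero:
  assumes "sublinear q" shows "q 0 = 0"
  using sublinear_scaleR_le[OF assms, of 2 0] sublinear_scaleR_le[OF assms, of "1/2" 0] by simp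

lemma sublinear_scaleR:
  assumes q: "sublinear q" and a: "a \<ge> 0"
  shows "q (a *\<^sub>R x) = a * q x"
proof (cases "a = 0")
  case False
  then have "a > 0" using a by simp
  moreover have "q x \<le> inverse a * q (a *\<^sub>R x)"
    using sublinear_scaleR_le[OF q, of "inverse a" "a *\<^sub>R x"] \<open>a > 0\<close> by simp
  ultimately have "a * q x \<le> q (a *\<^sub>R x)" by (simp add: field_simps)
  then show ?thesis using sublinear_scaleR_le[OF q \<open>a > 0\<close>, of x] by simp
qed (simp add: sublinear_zero[OF q])

lemma sublinear_lower: "sublinear q \<Longrightarrow> - q (- x) \<le> q x"
  using sublinear_add[of q x "- x"] sublinear_zero[of q] by simp

text \<open>For sublinear \<open>q\<close>, the largest sublinear functional below \<open>q\<close> whose value at \<open>- u\<close> is at most \<open>- q u\<close>. A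
  linear functional below it is therefore forced to agree with \<open>q\<close> at \<open>u\<close>.\<close>

definition tilt :: "('a::real_vector \<Rightarrow> real) \<Rightarrow> 'a \<Rightarrow> 'a \<Rightarrow> real" where
  "tilt q u z = (INF t\<in>{0..}. q (z + t *\<^sub>R u) - t * q u)"

lemma tilt_le:
  assumes q: "sublinear q" and t: "t \<ge> 0"
  shows "tilt q u z \<le> q (z + t *\<^sub>R u) - t * q u"
proof -
  have "bdd_below ((\<lambda>t. q (z + t *\<^sub>R u) - t * q u) ` {0..})"
  proof (rule bdd_belowI2[where m = "- q (- z)"])
    fix s :: real assume "s \<in> {0..}"
    then have "s * q u = q (s *\<^sub>R u)" using sublinear_scaleR[OF q] by simp
    also have "\<dots> \<le> q (z + s *\<^sub>R u) + q (- z)"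
      using sublinear_add[OF q, of "z + s *\<^sub>R u" "- z"] by simp
    finally show "- q (- z) \<le> q (z + s *\<^sub>R u) - s * q u" by simp
  qed
  then show ?thesis unfolding tilt_def using t by (intro cINF_lower) auto
qed

lemma tilt_greatest:
  assumes "\<And>t. t \<ge> 0 \<Longrightarrow> m \<le> q (z + t *\<^sub>R u) - t * q u"
  shows "m \<le> tilt q u z"
  unfolding tilt_def using assms by (intro cINF_greatest) auto

lemma sublinear_tilt:
  assumes q: "sublinear q"
  shows "sublinear (tilt q u)"
proof (rule sublinearI)
  fix x y
  have *: "tilt q u (x + y) \<le> (q (x + s *\<^sub>R u) - s * q u) + (q (y + t *\<^sub>R u) - t * q u)"
    if "s \<ge> 0" "t \<ge> 0" for s t
    using tilt_le[OF q, of "s + t" u "x + y"] that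
      sublinear_add[OF q, of "x + s *\<^sub>R u" "y + t *\<^sub>R u"]
    by (simp add: algebra_simps)
  have "tilt q u (x + y) - (q (x + s *\<^sub>R u) - s * q u) \<le> tilt q u y" if "s \<ge> 0" for s
    using *[OF that] by (intro tilt_greatest) (simp add: algebra_simps)
  then have "tilt q u (x + y) - tilt q u y \<le> tilt q u x"
    by (intro tilt_greatest) (simp add: algebra_simps)
  then show "tilt q u (x + y) \<le> tilt q u x + tilt q u y" by simp
next
  fix a :: real and x assume a: "a > 0"
  have "inverse a * tilt q u (a *\<^sub>R x) \<le> tilt q u x"
  proof (rule tilt_greatest)
    fix t :: real assume "t \<ge> 0"
    then have "tilt q u (a *\<^sub>R x) \<le> q (a *\<^sub>R (x + t *\<^sub>R u)) - (a * t) * q u"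
      using tilt_le[OF q, of "a * t" u "a *\<^sub>R x"] a by (simp add: algebra_simps)
    also have "\<dots> = a * (q (x + t *\<^sub>R u) - t * q u)"
      using sublinear_scaleR[OF q, of a "x + t *\<^sub>R u"] a by (simp add: right_diff_distrib)
    finally show "inverse a * tilt q u (a *\<^sub>R x) \<le> q (x + t *\<^sub>R u) - t * q u"
      using a by (simp add: field_simps)
  qed
  then show "tilt q u (a *\<^sub>R x) \<le> a * tilt q u x" using a by (simp add: field_simps)
qed

lemma tilt_below: "sublinear q \<Longrightarrow> tilt q u x \<le> q x"
  using tilt_le[of q 0 u x] by simp

lemma tilt_uminus: "sublinear q \<Longrightarrow> tilt q u (- u) \<le> - q u"
  using tilt_le[of q 1 u "- u"] by (simp add: sublinear_zero)

text \<open>Tilting a minimal functional in any direction changes nothing, and so it is odd; an odd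
  functional that is subadditive is also superadditive.\<close>

lemma minimal_sublinear_linear:
  assumes q: "sublinear q"
    and minimal: "\<And>q'. sublinear q' \<Longrightarrow> (\<And>x. q' x \<le> q x) \<Longrightarrow> q' = q"
  shows "linear q"
proof -
  have "tilt q u = q" for u
    using minimal sublinear_tilt tilt_below q by blast
  then have odd: "q (- u) = - q u" for u
    using tilt_uminus[OF q, of u] sublinear_lower[OF q, of u] by simp
  show ?thesis
  proof (rule linearI)
    fix x y
    show "q (x + y) = q x + q y"
      using sublinear_add[OF q, of x y] sublinear_add[OF q, of "- x" "- y"]
        odd[of x] odd[of y] odd[of "x + y"] by simp
  next
    fix a x
    show "q (a *\<^sub>R x) = a *\<^sub>R q x"
    proof (cases "a \<ge> 0")
      case False
      then have "q ((- a) *\<^sub>R x) = - a * q x" using sublinear_scaleR[OF q, of "- a"] by simp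
      then show ?thesis using odd[of "a *\<^sub>R x"] by simp
    qed (simp add: sublinear_scaleR[OF q])
  qed
qed

text \<open>The common upper bound \<open>P\<close> keeps the infimum finite, since \<open>q x \<ge> - q (- x) \<ge> - P (- x)\<close>.
  Subadditivity needs a chain: the bound \<open>q x + q' y\<close> is obtained from the smaller of the two.\<close>

lemma sublinear_chain_Inf:
  assumes ne: "C \<noteq> {}" and sub: "\<And>q. q \<in> C \<Longrightarrow> sublinear q"
    and chain: "\<And>q q'. q \<in> C \<Longrightarrow> q' \<in> C \<Longrightarrow> q \<le> q' \<or> q' \<le> q"
    and below: "\<And>q x. q \<in> C \<Longrightarrow> q x \<le> P x"
  shows "sublinear (\<lambda>x. INF q\<in>C. q x)" and "\<And>q x. q \<in> C \<Longrightarrow> (INF q\<in>C. q x) \<le> q x"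
proof -
  have lower: "(INF q\<in>C. q x) \<le> q x" if "q \<in> C" for q x
  proof (rule cINF_lower[OF _ that], rule bdd_belowI2)
    fix q assume "q \<in> C"
    then show "- P (- x) \<le> q x" using sublinear_lower[OF sub, of q x] below[of q "- x"] by simp
  qed
  then show "\<And>q x. q \<in> C \<Longrightarrow> (INF q\<in>C. q x) \<le> q x" .
  show "sublinear (\<lambda>x. INF q\<in>C. q x)"
  proof (rule sublinearI)
    fix x y
    have *: "(INF q\<in>C. q (x + y)) \<le> q x + q' y" if q: "q \<in> C" "q' \<in> C" for q q'
    proof -
      obtain q'' where "q'' \<in> C" "q'' x \<le> q x" "q'' y \<le> q' y"
        using chain[OF q] q by (auto simp: le_fun_def)
      then show ?thesis
        using lower[of q'' "x + y"] sublinear_add[OF sub, of q'' x y] by simp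
    qed
    have "(INF q\<in>C. q (x + y)) - q x \<le> (INF q\<in>C. q y)" if "q \<in> C" for q
      using *[OF that] by (intro cINF_greatest[OF ne]) (simp add: algebra_simps)
    then have "(INF q\<in>C. q (x + y)) - (INF q\<in>C. q y) \<le> (INF q\<in>C. q x)"
      by (intro cINF_greatest[OF ne]) (simp add: algebra_simps)
    then show "(INF q\<in>C. q (x + y)) \<le> (INF q\<in>C. q x) + (INF q\<in>C. q y)" by simp
  next
    fix a :: real and x assume a: "a > 0"
    have "inverse a * (INF q\<in>C. q (a *\<^sub>R x)) \<le> (INF q\<in>C. q x)"
    proof (rule cINF_greatest[OF ne])
      fix q assume "q \<in> C"
      then have "(INF q\<in>C. q (a *\<^sub>R x)) \<le> a * q x"
        using lower[of q "a *\<^sub>R x"] sublinear_scaleR_le[OF sub a, of q x] by simp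
      then show "inverse a * (INF q\<in>C. q (a *\<^sub>R x)) \<le> q x" using a by (simp add: field_simps)
    qed
    then show "(INF q\<in>C. q (a *\<^sub>R x)) \<le> a * (INF q\<in>C. q x)" using a by (simp add: field_simps)
  qed
qed

text \<open>By Zorn's lemma there is a minimal sublinear functional below \<open>tilt q u\<close>. It is
  linear, and the tilt makes it attain \<open>q u\<close> at \<open>u\<close>.\<close>

theorem hahn_banach:
  fixes q :: "'a::real_vector \<Rightarrow> real"
  assumes q: "sublinear q"
  obtains f where "linear f" "\<And>x. f x \<le> q x" "f u = q u"
proof -
  define A where "A = {g. sublinear g \<and> g \<le> tilt q u}"
  let ?P = "\<lambda>g g' :: 'a \<Rightarrow> real. g' \<le> g"
  have "partial_order_on A (relation_of ?P A)"
    by (auto simp: partial_order_on_def preorder_on_def refl_on_def trans_def antisym_def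
        relation_of_def)
  moreover have "\<exists>g\<in>A. \<forall>a\<in>C. ?P a g" if C: "C \<in> Chains (relation_of ?P A)" for C
  proof (cases "C = {}")
    case True
    have "tilt q u \<in> A" using sublinear_tilt[OF q] by (simp add: A_def)
    then show ?thesis using True by blast
  next
    case False
    have CA: "C \<subseteq> A" and chain: "\<And>g g'. g \<in> C \<Longrightarrow> g' \<in> C \<Longrightarrow> g \<le> g' \<or> g' \<le> g"
      using C by (auto simp: Chains_def relation_of_def)
    have sub: "\<And>g. g \<in> C \<Longrightarrow> sublinear g" and below: "\<And>g x. g \<in> C \<Longrightarrow> g x \<le> tilt q u x"
      using CA by (auto simp: A_def le_fun_def)
    have inf: "sublinear (\<lambda>x. INF g\<in>C. g x)" "\<And>g x. g \<in> C \<Longrightarrow> (INF g\<in>C. g x) \<le> g x"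
      using sublinear_chain_Inf[of C "tilt q u"] False sub chain below by blast+
    have "(\<lambda>x. INF g\<in>C. g x) \<le> tilt q u"
    proof (rule le_funI)
      fix x
      obtain g where "g \<in> C" using False by blast
      then show "(INF g\<in>C. g x) \<le> tilt q u x" using inf(2)[of g x] below[of g x] by simp
    qed
    then have "(\<lambda>x. INF g\<in>C. g x) \<in> A" using inf(1) by (simp add: A_def)
    moreover have "\<forall>g\<in>C. (\<lambda>x. INF g\<in>C. g x) \<le> g" using inf(2) by (simp add: le_fun_def)
    ultimately show ?thesis by blast
  qed
  ultimately obtain f where f: "f \<in> A" and minimal: "\<forall>a\<in>A. a \<le> f \<longrightarrow> a = f"
    using predicate_Zorn[of A ?P] by blast
  have sub: "sublinear f" and le: "\<And>x. f x \<le> tilt q u x"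
    using f by (auto simp: A_def le_fun_def)
  have "linear f"
  proof (rule minimal_sublinear_linear[OF sub])
    fix g assume g: "sublinear g" "\<And>x. g x \<le> f x"
    then have "g \<in> A" using le by (auto simp: A_def le_fun_def intro: order_trans)
    then show "g = f" using minimal g(2) by (simp add: le_fun_def)
  qed
  moreover have below: "f x \<le> q x" for x using le[of x] tilt_below[OF q, of u x] by simp
  moreover have "f u = q u"
    using le[of "- u"] tilt_uminus[OF q, of u] linear_neg[OF \<open>linear f\<close>, of u] below[of u] by simp
  ultimately show ?thesis using that by blast
qed

lemma blinfun_of_dominated:
  fixes f :: "'a::real_normed_vector \<Rightarrow> real"
  assumes f: "linear f" and bound: "\<And>x. f x \<le> K * norm x"
  obtains F :: "'a \<Rightarrow>\<^sub>L real" where "blinfun_apply F = f"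
proof -
  have "norm (f x) \<le> norm x * K" for x
    using bound[of x] bound[of "- x"] linear_neg[OF f, of x] by (simp add: abs_le_iff mult.commute)
  then have "bounded_linear f"
    using f by (intro bounded_linear_intro[of f K]) (auto simp: linear_add linear_scale)
  then show ?thesis using that bounded_linear_Blinfun_apply by blast
qed

lemma sublinear_infdist:
  fixes V :: "'a::real_normed_vector set"
  assumes V: "subspace V"
  shows "sublinear (\<lambda>x. infdist x V)"
proof (rule sublinearI)
  have ne: "V \<noteq> {}" using subspace_0[OF V] by blast
  fix x y
  have *: "infdist (x + y) V \<le> dist x v + dist y w" if "v \<in> V" "w \<in> V" for v w
    using infdist_le[OF subspace_add[OF V that], of "x + y"] dist_triangle_add[of x y v w] by simp
  have "infdist (x + y) V - dist x v \<le> infdist y V" if "v \<in> V" for v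
    unfolding infdist_notempty[OF ne, of y] using *[OF that]
    by (intro cINF_greatest[OF ne]) (simp add: algebra_simps)
  then have "infdist (x + y) V - infdist y V \<le> infdist x V"
    unfolding infdist_notempty[OF ne, of x]
    by (intro cINF_greatest[OF ne]) (simp add: algebra_simps)
  then show "infdist (x + y) V \<le> infdist x V + infdist y V" by simp
next
  have ne: "V \<noteq> {}" using subspace_0[OF V] by blast
  fix a :: real and x assume a: "a > 0"
  have "inverse a * infdist (a *\<^sub>R x) V \<le> infdist x V"
    unfolding infdist_notempty[OF ne, of x]
  proof (rule cINF_greatest[OF ne])
    fix v assume "v \<in> V"
    then have "infdist (a *\<^sub>R x) V \<le> dist (a *\<^sub>R x) (a *\<^sub>R v)"
      using V by (intro infdist_le) (simp add: subspace_scale)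
    also have "\<dots> = a * dist x v"
      using a by (simp add: dist_norm flip: scaleR_diff_right)
    finally show "inverse a * infdist (a *\<^sub>R x) V \<le> dist x v" using a by (simp add: field_simps)
  qed
  then show "infdist (a *\<^sub>R x) V \<le> a * infdist x V" using a by (simp add: field_simps)
qed

text \<open>The distance to a subspace is sublinear, vanishes on the subspace and is at most the
  norm. So the Hahn--Banach theorem for this functional yields at once the functional separating \<open>u\<close> from
  a closed subspace and, for the zero subspace, the functional norming \<open>u\<close>.\<close>

lemma functional_attaining_infdist:
  fixes V :: "'a::real_normed_vector set"
  assumes V: "subspace V"
  obtains f :: "'a \<Rightarrow>\<^sub>L real" where
    "\<And>v. v \<in> V \<Longrightarrow> f v = 0" "f u = infdist u V" "\<And>x. f x \<le> norm x"
proof -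
  obtain g where g: "linear g" "\<And>x. g x \<le> infdist x V" "g u = infdist u V"
    using hahn_banach[OF sublinear_infdist[OF V]] by blast
  have le: "g x \<le> 1 * norm x" for x
    using g(2)[of x] infdist_le[OF subspace_0[OF V], of x] by simp
  obtain f :: "'a \<Rightarrow>\<^sub>L real" where f: "blinfun_apply f = g"
    using blinfun_of_dominated[OF g(1) le] by blast
  have "g v = 0" if "v \<in> V" for v
    using g(2)[of v] g(2)[of "- v"] that subspace_neg[OF V that] linear_neg[OF g(1), of v] by simp
  then show ?thesis using that[of f] g(3) le by (simp add: f)
qed

corollary norming_functional:
  fixes u :: "'a::real_normed_vector"
  obtains f :: "'a \<Rightarrow>\<^sub>L real" where "f u = norm u" "\<And>x. f x \<le> norm x"
  using functional_attaining_infdist[OF subspace_single_0, of u] by (auto simp: infdist_def)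

section \<open>Weak sequential compactness in reflexive spaces\<close>

text \<open>The upper limit of \<open>f (x n)\<close>, as a real number. Sums of eventual upper bounds are
  eventual upper bounds, so this form gives sublinearity in \<open>f\<close> directly.\<close>

definition upper_limit :: "(nat \<Rightarrow> 'a::real_normed_vector) \<Rightarrow> ('a \<Rightarrow>\<^sub>L real) \<Rightarrow> real" where
  "upper_limit x f = Inf {c. \<forall>\<^sub>F n in sequentially. f (x n) \<le> c}"

context
  fixes x :: "nat \<Rightarrow> 'a::real_normed_vector" and R :: real
  assumes bounded: "\<And>n. norm (x n) \<le> R"
begin

lemma abs_apply_le: "\<bar>blinfun_apply f (x n)\<bar> \<le> norm f * R"
  using norm_blinfun[of f "x n"] mult_left_mono[OF bounded[of n], of "norm f"] by simp

lemma upper_limit_le: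
  assumes "\<forall>\<^sub>F n in sequentially. blinfun_apply f (x n) \<le> c"
  shows "upper_limit x f \<le> c"
  unfolding upper_limit_def
proof (rule cInf_lower)
  show "bdd_below {c. \<forall>\<^sub>F n in sequentially. f (x n) \<le> c}"
  proof (rule bdd_belowI)
    fix c assume "c \<in> {c. \<forall>\<^sub>F n in sequentially. f (x n) \<le> c}"
    then obtain n where "f (x n) \<le> c" by (auto simp: eventually_sequentially)
    then show "- (norm f * R) \<le> c" using abs_apply_le[of f n] by simp
  qed
qed (use assms in simp)

lemma eventually_le_upper_limit:
  assumes "upper_limit x f < c"
  shows "\<forall>\<^sub>F n in sequentially. blinfun_apply f (x n) \<le> c"
proof -
  have "{c. \<forall>\<^sub>F n in sequentially. f (x n) \<le> c} \<noteq> {}"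
    using abs_apply_le[of f] by (auto simp: abs_le_iff intro!: exI[of _ "norm f * R"])
  then obtain b where "\<forall>\<^sub>F n in sequentially. f (x n) \<le> b" "b < c"
    using cInf_lessD[OF _ assms[unfolded upper_limit_def]] by blast
  then show ?thesis by (auto elim: eventually_mono)
qed

lemma sublinear_upper_limit: "sublinear (upper_limit x)"
proof (rule sublinearI)
  fix f g :: "'a \<Rightarrow>\<^sub>L real"
  show "upper_limit x (f + g) \<le> upper_limit x f + upper_limit x g"
  proof (rule field_le_epsilon)
    fix e :: real assume e: "e > 0"
    have "\<forall>\<^sub>F n in sequentially. f (x n) \<le> upper_limit x f + e / 2"
      "\<forall>\<^sub>F n in sequentially. g (x n) \<le> upper_limit x g + e / 2"
      using e by (auto intro!: eventually_le_upper_limit)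
    then have "\<forall>\<^sub>F n in sequentially. (f + g) (x n) \<le> upper_limit x f + upper_limit x g + e"
      by eventually_elim (simp add: blinfun.add_left)
    then show "upper_limit x (f + g) \<le> upper_limit x f + upper_limit x g + e"
      by (rule upper_limit_le)
  qed
next
  fix a :: real and f :: "'a \<Rightarrow>\<^sub>L real" assume a: "a > 0"
  show "upper_limit x (a *\<^sub>R f) \<le> a * upper_limit x f"
  proof (rule field_le_epsilon)
    fix e :: real assume "e > 0"
    then have "\<forall>\<^sub>F n in sequentially. f (x n) \<le> upper_limit x f + e / a"
      using a by (intro eventually_le_upper_limit) simp
    then have "\<forall>\<^sub>F n in sequentially. (a *\<^sub>R f) (x n) \<le> a * upper_limit x f + e"
      by eventually_elim (use a in \<open>simp add: blinfun.scaleR_left field_simps\<close>)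
    then show "upper_limit x (a *\<^sub>R f) \<le> a * upper_limit x f + e"
      by (rule upper_limit_le)
  qed
qed

text \<open>Evaluation at a weak cluster point \<open>u\<close> of the sequence lies below the upper limit. Here such
  points are produced without any topology, with a prescribed value at one functional
  \<open>f\<^sub>0\<close>: they represent the linear functionals dominated by the upper limit.\<close>

lemma upper_limit_attained:
  assumes refl: "reflexive_space TYPE('a)"
  shows "\<exists>u. (\<forall>f. blinfun_apply f u \<le> upper_limit x f) \<and> blinfun_apply f\<^sub>0 u = upper_limit x f\<^sub>0"
proof -
  obtain g where g: "linear g" "\<And>f. g f \<le> upper_limit x f" "g f\<^sub>0 = upper_limit x f\<^sub>0"
    using hahn_banach[OF sublinear_upper_limit] by blast
  have "upper_limit x f \<le> R * norm f" for f
    using abs_apply_le[of f] by (intro upper_limit_le) (auto simp: abs_le_iff mult.commute)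
  then have le: "g f \<le> R * norm f" for f
    using g(2) order_trans by blast
  obtain \<xi> :: "('a \<Rightarrow>\<^sub>L real) \<Rightarrow>\<^sub>L real" where \<xi>: "blinfun_apply \<xi> = g"
    using blinfun_of_dominated[OF g(1) le] by blast
  then obtain u where "g f = f u" for f
    using refl by (metis reflexive_space_def)
  then have "(\<forall>f. blinfun_apply f u \<le> upper_limit x f) \<and> f\<^sub>0 u = upper_limit x f\<^sub>0" using g(2,3) by simp
  then show ?thesis by blast
qed

end

text \<open>Coefficients are given by lists because these form a countable type: the combinations are then
  enumerated by \<open>from_nat\<close>.\<close>

definition rational_combination :: "(nat \<Rightarrow> 'a::real_vector) \<Rightarrow> rat list \<Rightarrow> 'a" where
  "rational_combination x qs = (\<Sum>i<length qs. real_of_rat (qs ! i) *\<^sub>R x i)"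

lemma span_subset_closure_rational_combinations:
  fixes x :: "nat \<Rightarrow> 'a::real_normed_vector"
  shows "span (range x) \<subseteq> closure (range (rational_combination x))"
proof
  fix y assume "y \<in> span (range x)"
  then obtain t c where t: "finite t" "t \<subseteq> range x" and y: "y = (\<Sum>a\<in>t. c a *\<^sub>R a)"
    by (auto simp: span_explicit)
  obtain T where T: "T \<subseteq> UNIV" "inj_on x T" "t = x ` T"
    using subset_image_inj[of t x UNIV] t by blast
  then have "finite T" using t(1) finite_image_iff by blast
  then obtain N where N: "T \<subseteq> {..<N}" using finite_nat_iff_bounded by blast
  define d where "d i = (if i \<in> T then c (x i) else 0)" for i
  have "y = (\<Sum>i\<in>T. c (x i) *\<^sub>R x i)" unfolding y T(3) by (simp add: sum.reindex[OF T(2)])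
  also have "\<dots> = (\<Sum>i<N. d i *\<^sub>R x i)"
    using N by (intro sum.mono_neutral_cong_left) (auto simp: d_def)
  finally have yN: "y = (\<Sum>i<N. d i *\<^sub>R x i)" .
  have "\<exists>q :: nat \<Rightarrow> rat. (\<lambda>n. real_of_rat (q n)) \<longlonglongrightarrow> a" for a :: real
  proof -
    have "\<exists>q. a < real_of_rat q \<and> real_of_rat q < a + 1 / Suc n" for n
      by (rule of_rat_dense) simp
    then obtain q where q: "\<And>n. a < real_of_rat (q n) \<and> real_of_rat (q n) < a + 1 / Suc n" by metis
    have lim: "(\<lambda>n. a + 1 / Suc n) \<longlonglongrightarrow> a"
      using tendsto_add[OF tendsto_const LIMSEQ_inverse_real_of_nat, of a]
      by (simp add: inverse_eq_divide)
    have "\<forall>\<^sub>F n in sequentially. a \<le> real_of_rat (q n)"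
      "\<forall>\<^sub>F n in sequentially. real_of_rat (q n) \<le> a + 1 / Suc n"
      by (intro always_eventually allI less_imp_le; simp add: q del: of_nat_Suc)+
    then have "(\<lambda>n. real_of_rat (q n)) \<longlonglongrightarrow> a"
      by (rule tendsto_sandwich[OF _ _ tendsto_const lim])
    then show ?thesis by blast
  qed
  then have "\<forall>i. \<exists>q :: nat \<Rightarrow> rat. (\<lambda>n. real_of_rat (q n)) \<longlonglongrightarrow> d i" by blast
  then obtain q :: "nat \<Rightarrow> nat \<Rightarrow> rat" where q: "\<And>i. (\<lambda>n. real_of_rat (q i n)) \<longlonglongrightarrow> d i"
    using choice[of "\<lambda>i q. (\<lambda>n. real_of_rat (q n)) \<longlonglongrightarrow> d i"] by blast
  define z where "z n = rational_combination x (map (\<lambda>i. q i n) [0..<N])" for n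
  have z_eq: "z = (\<lambda>n. \<Sum>i<N. real_of_rat (q i n) *\<^sub>R x i)"
    by (simp add: z_def [abs_def] rational_combination_def)
  have "z \<longlonglongrightarrow> y"
    unfolding yN z_eq by (intro tendsto_intros q)
  moreover have "z n \<in> range (rational_combination x)" for n by (simp add: z_def)
  ultimately show "y \<in> closure (range (rational_combination x))"
    using closure_sequential by blast
qed

text \<open>Take norming functionals of the points \<open>d k\<close> of a countable dense set. If \<open>d k\<close> is close to
  \<open>y \<noteq> 0\<close>, then the functional norming \<open>d k\<close> cannot vanish at \<open>y\<close>.\<close>

lemma countable_separating_functionals:
  fixes x :: "nat \<Rightarrow> 'a::real_normed_vector"
  obtains F :: "nat \<Rightarrow> 'a \<Rightarrow>\<^sub>L real" where
    "\<And>y. y \<in> closure (span (range x)) \<Longrightarrow> (\<And>k. F k y = 0) \<Longrightarrow> y = 0"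
proof -
  define d where "d k = rational_combination x (from_nat k)" for k
  have "\<exists>f :: 'a \<Rightarrow>\<^sub>L real. f (d k) = norm (d k) \<and> (\<forall>y. f y \<le> norm y)" for k
    using norming_functional[of "d k"] by metis
  then obtain F :: "nat \<Rightarrow> 'a \<Rightarrow>\<^sub>L real"
    where F: "\<And>k. F k (d k) = norm (d k)" "\<And>k y. F k y \<le> norm y" by metis
  have "y = 0" if y: "y \<in> closure (span (range x))" and 0: "\<And>k. F k y = 0" for y
  proof (rule ccontr)
    assume "y \<noteq> 0"
    then have "norm y / 2 > 0" by simp
    moreover have "y \<in> closure (range (rational_combination x))"
      using y closure_mono[OF span_subset_closure_rational_combinations[of x]] by auto
    ultimately have "\<exists>z\<in>range (rational_combination x). dist z y < norm y / 2"
      unfolding closure_approachable by blast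
    then obtain qs where qs: "dist (rational_combination x qs) y < norm y / 2" by blast
    obtain k where k: "qs = from_nat k" by (metis from_nat_to_nat)
    have "norm (d k) = F k (d k - y)" using F(1) 0 by (simp add: blinfun.diff_right)
    also have "\<dots> \<le> norm (d k - y)" by (rule F(2))
    finally have "norm (d k) < norm y / 2" using qs k by (simp add: d_def dist_norm)
    moreover have "norm (d k - y) < norm y / 2" using qs k by (simp add: d_def dist_norm)
    ultimately show False using norm_triangle_ineq2[of y "d k"] norm_minus_commute[of y "d k"] by simp
  qed
  then show ?thesis using that by blast
qed

text \<open>The diagonal argument, in the form that a countable product of compact intervals is
  compact and metrisable, hence sequentially compact.\<close>

lemma diagonal_convergent_subsequence:
  fixes a :: "nat \<Rightarrow> nat \<Rightarrow> real"
  assumes "\<And>n k. \<bar>a n k\<bar> \<le> B k"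
  obtains s l where "strict_mono s" "\<And>k. (\<lambda>n. a (s n) k) \<longlonglongrightarrow> l k"
proof -
  let ?K = "PiE UNIV (\<lambda>k. {- B k .. B k})"
  have "compact ?K"
    using compactin_PiE[of "\<lambda>_ :: nat. euclideanreal" UNIV "\<lambda>k. {- B k .. B k}"]
    by (simp add: euclidean_product_topology)
  then have "seq_compact ?K" by (rule compact_imp_seq_compact)
  moreover have "a n \<in> ?K" for n using assms by (auto simp: abs_le_iff minus_le_iff)
  ultimately obtain l s where s: "strict_mono s" "(a \<circ> s) \<longlonglongrightarrow> l"
    unfolding seq_compact_def by metis
  have "(\<lambda>n. a (s n) k) \<longlonglongrightarrow> l k" for k
    using continuous_on_tendsto_compose[OF continuous_on_product_coordinates[of k] s(2)]
    by (simp add: o_def)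
  then show ?thesis using that s(1) by blast
qed

text \<open>Choose the subsequence so that countably many functionals separating the points of the
  closed span converge along it. Any \<open>u\<close> whose evaluation lies below the upper limit belongs to the closed
  span, as a functional vanishing on the span has upper limit \<open>0\<close>, and its values at the
  countably many functionals are the given limits. So \<open>u\<close> is unique. On the other hand, for every \<open>f\<close>
  some such point attains the upper limit of \<open>f\<close> and some such point attains that of \<open>- f\<close>; as both are
  \<open>u\<close>, the upper and lower limits of \<open>f\<close> coincide with \<open>f u\<close>.\<close>

theorem reflexive_weakly_convergent_subsequence:
  fixes x :: "nat \<Rightarrow> 'a::real_normed_vector"
  assumes refl: "reflexive_space TYPE('a)" and bounded: "\<And>n. norm (x n) \<le> R"
  obtains s u where "strict_mono s" "weakly_tendsto (x \<circ> s) u"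
proof -
  obtain F :: "nat \<Rightarrow> 'a \<Rightarrow>\<^sub>L real" where
    F: "\<And>y. y \<in> closure (span (range x)) \<Longrightarrow> (\<And>k. F k y = 0) \<Longrightarrow> y = 0"
    using countable_separating_functionals by blast
  have "\<bar>F k (x n)\<bar> \<le> norm (F k) * R" for n k by (rule abs_apply_le[of x, OF bounded])
  then obtain s l where s: "strict_mono s" and l: "\<And>k. (\<lambda>n. F k (x (s n))) \<longlonglongrightarrow> l k"
    by (rule diagonal_convergent_subsequence[of "\<lambda>n k. F k (x n)"]) blast
  define y where "y = x \<circ> s"
  have bd: "norm (y n) \<le> R" for n using bounded by (simp add: y_def)
  have point_in_span: "u \<in> closure (span (range x))" if u: "\<And>f. blinfun_apply f u \<le> upper_limit y f" for u
  proof (rule ccontr)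
    assume nu: "u \<notin> closure (span (range x))"
    obtain f :: "'a \<Rightarrow>\<^sub>L real" where
      f: "\<And>v. v \<in> span (range x) \<Longrightarrow> f v = 0" "f u = infdist u (span (range x))"
      using functional_attaining_infdist[OF subspace_span] by blast
    have "upper_limit y f \<le> 0"
      by (intro upper_limit_le[of y, OF bd]) (simp add: y_def f(1) span_base)
    then have "infdist u (span (range x)) \<le> 0" using u[of f] f(2) by simp
    then have "infdist u (span (range x)) = 0" using infdist_nonneg[of u "span (range x)"] by simp
    then show False
      using nu in_closure_iff_infdist_zero[of "span (range x)" u] span_zero by blast
  qed
  have point_value: "F k u = l k" if u: "\<And>f. blinfun_apply f u \<le> upper_limit y f" for u k
  proof -
    have "F k u \<le> l k + e" if "e > 0" for e
    proof -
      have "\<forall>\<^sub>F n in sequentially. F k (y n) < l k + e"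
        using order_tendstoD(2)[OF l] that by (simp add: y_def)
      then have "upper_limit y (F k) \<le> l k + e"
        by (intro upper_limit_le[of y, OF bd]) (auto elim: eventually_mono)
      then show ?thesis using u[of "F k"] by simp
    qed
    moreover have "l k \<le> F k u + e" if "e > 0" for e
    proof -
      have "\<forall>\<^sub>F n in sequentially. l k - e < F k (y n)"
        using order_tendstoD(1)[OF l] that by (simp add: y_def)
      then have "upper_limit y (- F k) \<le> e - l k"
        by (intro upper_limit_le[of y, OF bd]) (auto simp: blinfun.minus_left elim: eventually_mono)
      then show ?thesis using u[of "- F k"] by (simp add: blinfun.minus_left)
    qed
    ultimately show ?thesis by (rule antisym[OF field_le_epsilon field_le_epsilon])
  qed
  have unique: "u = v" if u: "\<And>f. blinfun_apply f u \<le> upper_limit y f"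
    and v: "\<And>f. blinfun_apply f v \<le> upper_limit y f" for u v
  proof -
    obtain a b where "\<And>n. a n \<in> span (range x)" "a \<longlonglongrightarrow> u" "\<And>n. b n \<in> span (range x)" "b \<longlonglongrightarrow> v"
      using point_in_span[OF u] point_in_span[OF v] unfolding closure_sequential by blast
    then have "\<And>n. a n - b n \<in> span (range x)" "(\<lambda>n. a n - b n) \<longlonglongrightarrow> u - v"
      by (auto intro: span_diff tendsto_diff)
    then have "u - v \<in> closure (span (range x))"
      unfolding closure_sequential by (intro exI[of _ "\<lambda>n. a n - b n"]) blast
    then have "u - v = 0"
    proof (rule F)
      show "F k (u - v) = 0" for k
        using point_value[OF u] point_value[OF v] by (simp add: blinfun.diff_right)
    qed
    then show ?thesis by simp
  qed
  obtain u where "\<forall>f. blinfun_apply f u \<le> upper_limit y f"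
    using upper_limit_attained[of y, OF bd refl, where f\<^sub>0 = "0 :: 'a \<Rightarrow>\<^sub>L real"] by blast
  then have u: "blinfun_apply f u \<le> upper_limit y f" for f by simp
  have upper: "upper_limit y f = f u" for f
  proof -
    obtain v where v: "\<forall>g. blinfun_apply g v \<le> upper_limit y g" "f v = upper_limit y f"
      using upper_limit_attained[of y, OF bd refl, where f\<^sub>0 = f] by blast
    have "u = v" by (rule unique[OF u]) (use v(1) in simp)
    then show ?thesis using v(2) by simp
  qed
  have "(\<lambda>n. f (y n)) \<longlonglongrightarrow> f u" for f :: "'a \<Rightarrow>\<^sub>L real"
  proof (rule order_tendstoI)
    fix a assume "a < f u"
    then obtain b where b: "a < b" "b < f u" using dense by blast
    then have "\<forall>\<^sub>F n in sequentially. (- f) (y n) \<le> - b"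
      using upper[of "- f"] by (intro eventually_le_upper_limit[of y, OF bd]) (simp add: blinfun.minus_left)
    then show "\<forall>\<^sub>F n in sequentially. a < f (y n)"
      by eventually_elim (use b in \<open>simp add: blinfun.minus_left\<close>)
  next
    fix a assume "f u < a"
    then obtain b where b: "f u < b" "b < a" using dense by blast
    then have "\<forall>\<^sub>F n in sequentially. f (y n) \<le> b"
      using upper[of f] by (intro eventually_le_upper_limit[of y, OF bd]) simp
    then show "\<forall>\<^sub>F n in sequentially. f (y n) < a"
      by eventually_elim (use b in simp)
  qed
  then have "weakly_tendsto y u" unfolding weakly_tendsto_iff by blast
  then show ?thesis using that s by (simp add: y_def)
qed

section \<open>Fibering maps and the Nehari set\<close>

lemma weakly_tendsto_scaleR:
  assumes "weakly_tendsto u l"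
  shows "weakly_tendsto (\<lambda>n. a *\<^sub>R u n) (a *\<^sub>R l)"
  using assms unfolding weakly_tendsto_iff by (simp add: blinfun.scaleR_right tendsto_mult_left)

lemma topspace_weak_topology: "topspace weak_topology = (UNIV :: 'a::real_normed_vector set)"
proof -
  have "weakly_tendsto (\<lambda>_. u) u" for u :: 'a unfolding weakly_tendsto_iff by simp
  then have "u \<in> topspace weak_topology" for u :: 'a unfolding limitin_def by blast
  then show ?thesis by blast
qed

lemma Liminf_pos_imp_pos_near:
  fixes g :: "'a::real_normed_vector \<Rightarrow> real"
  assumes "Liminf (at 0) (\<lambda>u. ereal (g u / norm u powr r)) > 0"
  obtains \<delta> where "\<delta> > 0" "\<And>u. u \<noteq> 0 \<Longrightarrow> norm u < \<delta> \<Longrightarrow> g u > 0"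
proof -
  have "\<forall>\<^sub>F u in at 0. 0 < g u / norm u powr r"
    using less_LiminfD[OF assms] by (auto elim!: eventually_mono)
  then obtain \<delta> where "\<delta> > 0" and \<delta>: "\<And>u. u \<noteq> 0 \<Longrightarrow> norm u < \<delta> \<Longrightarrow> 0 < g u / norm u powr r"
    by (auto simp: eventually_at)
  have "g u > 0" if "u \<noteq> 0" "norm u < \<delta>" for u
    using \<delta>[OF that] by (auto simp: zero_less_divide_iff)
  then show ?thesis using that \<open>\<delta> > 0\<close> by blast
qed

text \<open>The properties of \<open>\<Phi>\<close> along single rays. Weak topologies enter only in the existence of a
  minimiser, so the geometry of the fibres and criticality hold in any normed space.\<close>

locale nehari_fibering =
  fixes \<Phi> :: "'a::real_normed_vector \<Rightarrow> real"
    and \<Phi>' :: "'a \<Rightarrow> 'a \<Rightarrow>\<^sub>L real"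
    and p \<delta> :: real
  assumes C1: "C1_on UNIV \<Phi> \<Phi>'"
    and zero: "\<Phi> 0 = 0"
    and radius_pos: "\<delta> > 0"
    and pos_near_0: "\<And>u. u \<noteq> 0 \<Longrightarrow> norm u < \<delta> \<Longrightarrow> \<Phi>' u u > 0"
    and nonpos_far: "\<And>u. u \<noteq> 0 \<Longrightarrow> \<exists>t>0. \<Phi> (t *\<^sub>R u) \<le> 0"
    and decreasing: "\<And>u. u \<noteq> 0 \<Longrightarrow> strict_antimono_on {0<..} (\<lambda>t. \<Phi>' (t *\<^sub>R u) u / t powr (p - 1))"
begin

abbreviation N :: "'a set" where "N \<equiv> nehari_set \<Phi>'"

lemma has_derivative: "(\<Phi> has_derivative blinfun_apply (\<Phi>' u)) (at u)"
  using C1 by (simp add: C1_on_def)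

lemma continuous_derivative: "continuous_on UNIV \<Phi>'"
  using C1 by (simp add: C1_on_def)

lemma has_real_derivative_line:
  "((\<lambda>t. \<Phi> (a + t *\<^sub>R b)) has_real_derivative \<Phi>' (a + t *\<^sub>R b) b) (at t)"
proof -
  have "((\<lambda>t. a + t *\<^sub>R b) has_derivative (\<lambda>h. h *\<^sub>R b)) (at t)"
    by (auto intro!: derivative_eq_intros)
  from has_derivative_compose[OF this has_derivative]
  show ?thesis
    by (simp add: has_field_derivative_def blinfun.scaleR_right mult.commute[of _ "blinfun_apply _ _"])
qed

lemma has_real_derivative_ray:
  "((\<lambda>t. \<Phi> (t *\<^sub>R b)) has_real_derivative \<Phi>' (t *\<^sub>R b) b) (at t)"
  using has_real_derivative_line[of 0 b t] by simp

lemma continuous_on_derivative_apply [continuous_intros]: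
  "continuous_on S f \<Longrightarrow> continuous_on S g \<Longrightarrow> continuous_on S (\<lambda>t. \<Phi>' (f t) (g t))"
  by (intro continuous_intros continuous_on_compose2[OF continuous_derivative]) auto

lemma continuous_on_line: "continuous_on S (\<lambda>t. \<Phi> (a + t *\<^sub>R b))"
  by (rule DERIV_continuous_on[OF has_field_derivative_at_within[OF has_real_derivative_line]])

lemma continuous_on_ray: "continuous_on S (\<lambda>t. \<Phi> (t *\<^sub>R u))"
  using continuous_on_line[of S 0 u] by simp

lemma derivative_scaled: "\<Phi>' (t *\<^sub>R u) (t *\<^sub>R u) = t * \<Phi>' (t *\<^sub>R u) u"
  by (simp add: blinfun.scaleR_right)

lemma scaled_in_nehari_iff: "t > 0 \<Longrightarrow> t *\<^sub>R u \<in> N \<longleftrightarrow> u \<noteq> 0 \<and> \<Phi>' (t *\<^sub>R u) u = 0"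
  by (auto simp: nehari_set_def derivative_scaled)

lemma nehari_nonzero: "u \<in> N \<Longrightarrow> u \<noteq> 0" and nehari_derivative: "u \<in> N \<Longrightarrow> \<Phi>' u u = 0"
  by (simp_all add: nehari_set_def)

lemma nehari_norm_ge: "u \<in> N \<Longrightarrow> \<delta> \<le> norm u"
  using pos_near_0[of u] by (force simp: nehari_set_def)

text \<open>If the fibre derivative stayed positive, then \<open>\<Phi>\<close> would be positive along the whole ray.\<close>

lemma ray_meets_nehari:
  assumes u: "u \<noteq> 0"
  obtains t where "t > 0" "t *\<^sub>R u \<in> N"
proof -
  define s where "s = \<delta> / (2 * norm u)"
  have s: "s > 0" "norm (s *\<^sub>R u) < \<delta>" using u radius_pos by (auto simp: s_def)
  have start: "\<Phi>' (t *\<^sub>R u) u > 0" if "0 < t" "t \<le> s" for t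
  proof -
    have "norm (t *\<^sub>R u) \<le> norm (s *\<^sub>R u)" using that by (simp add: mult_right_mono)
    also note s(2)
    finally have "t * \<Phi>' (t *\<^sub>R u) u > 0"
      using pos_near_0[of "t *\<^sub>R u"] that u by (simp add: derivative_scaled)
    then show ?thesis using that by (simp add: zero_less_mult_iff)
  qed
  obtain T where T: "T > 0" "\<Phi> (T *\<^sub>R u) \<le> 0" using nonpos_far[OF u] by blast
  have "\<exists>t. 0 < t \<and> t < T \<and> \<Phi>' (t *\<^sub>R u) u \<le> 0"
  proof (rule ccontr)
    assume "\<not> ?thesis"
    then have "\<Phi> (0 *\<^sub>R u) < \<Phi> (T *\<^sub>R u)"
      using has_real_derivative_ray T(1)
      by (intro DERIV_pos_imp_increasing_open[OF _ _ continuous_on_ray]) (auto simp: not_le)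
    then show False using T zero by simp
  qed
  then obtain t where t: "0 < t" "\<Phi>' (t *\<^sub>R u) u \<le> 0" by blast
  then have "s \<le> t" using start[of t] by (cases "t \<le> s") auto
  then obtain z where "s \<le> z" "\<Phi>' (z *\<^sub>R u) u = 0"
    using IVT2'[of "\<lambda>z. \<Phi>' (z *\<^sub>R u) u" t 0 s] t(2) start[OF s(1)]
    by (force intro: continuous_intros)
  then show ?thesis using that[of z] s(1) u by (simp add: scaled_in_nehari_iff)
qed

text \<open>At a Nehari point the decreasing quotient \<open>\<Phi>' (t u) u / t powr (p - 1)\<close> passes through \<open>0\<close> at
  \<open>t = 1\<close>.\<close>

lemma
  assumes u: "u \<in> N"
  shows derivative_pos_before: "0 < t \<Longrightarrow> t < 1 \<Longrightarrow> \<Phi>' (t *\<^sub>R u) u > 0"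
    and derivative_neg_after: "1 < t \<Longrightarrow> \<Phi>' (t *\<^sub>R u) u < 0"
proof -
  have *: "\<Phi>' (b *\<^sub>R u) u / b powr (p - 1) < \<Phi>' (a *\<^sub>R u) u / a powr (p - 1)"
    if "0 < a" "a < b" for a b
    using monotone_onD[OF decreasing[OF nehari_nonzero[OF u]], of a b] that by simp
  show "\<Phi>' (t *\<^sub>R u) u > 0" if "0 < t" "t < 1"
    using *[of t 1] that nehari_derivative[OF u] by (simp add: zero_less_divide_iff)
  show "\<Phi>' (t *\<^sub>R u) u < 0" if "1 < t"
    using *[of 1 t] that nehari_derivative[OF u] by (simp add: divide_less_0_iff)
qed

lemma nehari_pos:
  assumes u: "u \<in> N"
  shows "\<Phi> u > 0"
proof -
  have "\<Phi> (0 *\<^sub>R u) < \<Phi> (1 *\<^sub>R u)"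
    using has_real_derivative_ray derivative_pos_before[OF u]
    by (intro DERIV_pos_imp_increasing_open[OF _ _ continuous_on_ray]) auto
  then show ?thesis by (simp add: zero)
qed

lemma nehari_max_on_ray:
  assumes u: "u \<in> N" and t: "t > 0"
  shows "\<Phi> (t *\<^sub>R u) \<le> \<Phi> u"
proof (cases t "1::real" rule: linorder_cases)
  case less
  have "\<Phi> (t *\<^sub>R u) < \<Phi> (1 *\<^sub>R u)"
  proof (rule DERIV_pos_imp_increasing_open[OF less _ continuous_on_ray])
    fix x assume "t < x" "x < 1"
    then show "\<exists>y. ((\<lambda>t. \<Phi> (t *\<^sub>R u)) has_real_derivative y) (at x) \<and> y > 0"
      using has_real_derivative_ray derivative_pos_before[OF u, of x] t by (meson less_trans)
  qed
  then show ?thesis by simp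
next
  case greater
  have "\<Phi> (t *\<^sub>R u) < \<Phi> (1 *\<^sub>R u)"
    using has_real_derivative_ray derivative_neg_after[OF u] greater
    by (intro DERIV_neg_imp_decreasing_open[OF _ _ continuous_on_ray]) auto
  then show ?thesis by simp
qed simp

text \<open>For a descent direction \<open>w\<close> at \<open>u\<close> and small \<open>e > 0\<close>, the ray of \<open>u + e w\<close> has a Nehari point
  \<open>s (u + e w)\<close> with \<open>s\<close> close to \<open>1\<close>. Comparing first along \<open>w\<close> and then along the ray of \<open>u\<close> gives
  \<open>\<Phi> (s (u + e w)) < \<Phi> (s u) \<le> \<Phi> u\<close>, so that \<open>u\<close> is not minimal.\<close>

lemma nehari_minimizer_critical:
  assumes u: "u \<in> N" and min: "\<And>v. v \<in> N \<Longrightarrow> \<Phi> u \<le> \<Phi> v"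
  shows "\<Phi>' u = 0"
proof (rule ccontr)
  assume "\<Phi>' u \<noteq> 0"
  then obtain w0 where "\<Phi>' u w0 \<noteq> 0" by (metis blinfun_eqI zero_blinfun.rep_eq)
  then have "\<Phi>' u w0 < 0 \<or> \<Phi>' u (- w0) < 0" by (auto simp: blinfun.minus_right)
  then obtain w where w: "\<Phi>' u w < 0" by blast
  have cont: "isCont (\<lambda>x. \<Phi>' x w) u"
    using continuous_on_derivative_apply[of UNIV id "\<lambda>_. w"] by (simp add: continuous_on_eq_continuous_at)
  have "\<forall>\<^sub>F x in nhds u. \<Phi>' x w < 0"
    using order_tendstoD(2)[OF cont[unfolded continuous_at] w] w
    by (simp add: eventually_nhds_conv_at)
  then obtain \<rho> where \<rho>: "\<rho> > 0" "\<And>x. dist x u < \<rho> \<Longrightarrow> \<Phi>' x w < 0"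
    by (auto simp: eventually_nhds_metric)
  \<comment> \<open>The window \<open>{1 - \<eta>..1 + \<eta>}\<close> for the dilation of the perturbed point uses up at most half of
      the radius \<open>\<rho>\<close> on which \<open>w\<close> is a descent direction; the perturbation uses the other half.\<close>
  define \<eta> where "\<eta> = min (1/2) (\<rho> / (4 * norm u))"
  have un: "norm u > 0" using nehari_nonzero[OF u] by simp
  have \<eta>: "0 < \<eta>" "\<eta> < 1" "\<eta> * norm u < \<rho> / 2"
  proof -
    show "0 < \<eta>" "\<eta> < 1" using \<rho>(1) un by (auto simp: \<eta>_def)
    have "\<eta> * norm u \<le> \<rho> / (4 * norm u) * norm u"
      by (intro mult_right_mono) (auto simp: \<eta>_def)
    then show "\<eta> * norm u < \<rho> / 2" using un \<rho>(1) by simp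
  qed
  have tend: "((\<lambda>e. \<Phi>' (s *\<^sub>R (u + e *\<^sub>R w)) (u + e *\<^sub>R w)) \<longlongrightarrow> \<Phi>' (s *\<^sub>R u) u) (at_right 0)" for s
  proof -
    have "continuous_on UNIV (\<lambda>e. \<Phi>' (s *\<^sub>R (u + e *\<^sub>R w)) (u + e *\<^sub>R w))"
      by (intro continuous_intros)
    then have "isCont (\<lambda>e. \<Phi>' (s *\<^sub>R (u + e *\<^sub>R w)) (u + e *\<^sub>R w)) 0"
      by (simp add: continuous_on_eq_continuous_at)
    then show ?thesis
      by (auto simp: isCont_def intro: filterlim_mono[OF _ order_refl at_le])
  qed
  have "((\<lambda>e. u + e *\<^sub>R w) \<longlongrightarrow> u + 0 *\<^sub>R w) (at_right 0)" by (intro tendsto_intros)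
  then have ev0: "\<forall>\<^sub>F e in at_right 0. u + e *\<^sub>R w \<noteq> 0"
    using un by (intro tendsto_imp_eventually_ne) auto
  have "((\<lambda>e. 2 * (e * norm w)) \<longlongrightarrow> 2 * (0 * norm w)) (at_right 0)" by (intro tendsto_intros)
  then have ev1: "\<forall>\<^sub>F e in at_right 0. 2 * (e * norm w) < \<rho> / 2"
    using \<rho>(1) by (intro order_tendstoD(2)) auto
  \<comment> \<open>The sign change of the fibre derivative at the ends of the window survives a small
      perturbation.\<close>
  have ev2: "\<forall>\<^sub>F e in at_right 0. \<Phi>' ((1 - \<eta>) *\<^sub>R (u + e *\<^sub>R w)) (u + e *\<^sub>R w) > 0"
    using order_tendstoD(1)[OF tend] derivative_pos_before[OF u, of "1 - \<eta>"] \<eta> by simp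
  have ev3: "\<forall>\<^sub>F e in at_right 0. \<Phi>' ((1 + \<eta>) *\<^sub>R (u + e *\<^sub>R w)) (u + e *\<^sub>R w) < 0"
    using order_tendstoD(2)[OF tend] derivative_neg_after[OF u, of "1 + \<eta>"] \<eta> by simp
  have "\<forall>\<^sub>F e in at_right (0::real). e > 0" by (simp add: eventually_at_right_less)
  then have "\<forall>\<^sub>F e in at_right 0. e > 0 \<and> u + e *\<^sub>R w \<noteq> 0 \<and> 2 * (e * norm w) < \<rho> / 2 \<and>
      \<Phi>' ((1 - \<eta>) *\<^sub>R (u + e *\<^sub>R w)) (u + e *\<^sub>R w) > 0 \<and>
      \<Phi>' ((1 + \<eta>) *\<^sub>R (u + e *\<^sub>R w)) (u + e *\<^sub>R w) < 0"
    using ev0 ev1 ev2 ev3 by eventually_elim blast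
  then obtain e where e: "e > 0" "u + e *\<^sub>R w \<noteq> 0" "2 * (e * norm w) < \<rho> / 2"
      "\<Phi>' ((1 - \<eta>) *\<^sub>R (u + e *\<^sub>R w)) (u + e *\<^sub>R w) > 0"
      "\<Phi>' ((1 + \<eta>) *\<^sub>R (u + e *\<^sub>R w)) (u + e *\<^sub>R w) < 0"
    using eventually_happens'[OF trivial_limit_at_right_real] by blast
  have "\<exists>s\<ge>1 - \<eta>. s \<le> 1 + \<eta> \<and> \<Phi>' (s *\<^sub>R (u + e *\<^sub>R w)) (u + e *\<^sub>R w) = 0"
    using e(4,5) \<eta> by (intro IVT2') (auto intro!: continuous_intros)
  then obtain s where s: "1 - \<eta> \<le> s" "s \<le> 1 + \<eta>" "\<Phi>' (s *\<^sub>R (u + e *\<^sub>R w)) (u + e *\<^sub>R w) = 0"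
    by blast
  have s0: "s > 0" using s(1) \<eta> by simp
  then have v: "s *\<^sub>R (u + e *\<^sub>R w) \<in> N" using e(2) s(3) by (simp add: scaled_in_nehari_iff)
  have near: "dist (s *\<^sub>R u + t *\<^sub>R (s *\<^sub>R w)) u < \<rho>" if t: "0 < t" "t < e" for t
  proof -
    have "dist (s *\<^sub>R u + t *\<^sub>R (s *\<^sub>R w)) u = norm ((s - 1) *\<^sub>R u + (t * s) *\<^sub>R w)"
      by (simp add: dist_norm algebra_simps)
    also have "\<dots> \<le> \<bar>s - 1\<bar> * norm u + (t * s) * norm w"
      using norm_triangle_ineq[of "(s - 1) *\<^sub>R u" "(t * s) *\<^sub>R w"] s0 t by simp
    also have "\<dots> \<le> \<eta> * norm u + (e * 2) * norm w"
      using s s0 t \<eta> by (intro add_mono mult_right_mono mult_mono) auto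
    also have "\<dots> < \<rho>" using \<eta>(3) e(3) by (simp add: algebra_simps)
    finally show ?thesis .
  qed
  have "\<Phi> (s *\<^sub>R u + e *\<^sub>R (s *\<^sub>R w)) < \<Phi> (s *\<^sub>R u + 0 *\<^sub>R (s *\<^sub>R w))"
  proof (rule DERIV_neg_imp_decreasing_open[OF e(1)])
    show "continuous_on {0..e} (\<lambda>t. \<Phi> (s *\<^sub>R u + t *\<^sub>R (s *\<^sub>R w)))"
      by (rule continuous_on_line)
    fix t assume "0 < t" "t < e"
    then have "\<Phi>' (s *\<^sub>R u + t *\<^sub>R (s *\<^sub>R w)) (s *\<^sub>R w) < 0"
      using \<rho>(2)[OF near] s0 by (simp add: blinfun.scaleR_right mult_pos_neg)
    then show "\<exists>y. ((\<lambda>t. \<Phi> (s *\<^sub>R u + t *\<^sub>R (s *\<^sub>R w))) has_real_derivative y) (at t) \<and> y < 0"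
      using has_real_derivative_line by blast
  qed
  moreover have "s *\<^sub>R (u + e *\<^sub>R w) = s *\<^sub>R u + e *\<^sub>R (s *\<^sub>R w)" by (simp add: algebra_simps)
  ultimately have "\<Phi> (s *\<^sub>R (u + e *\<^sub>R w)) < \<Phi> (s *\<^sub>R u)" by simp
  then show False using min[OF v] nehari_max_on_ray[OF u s0] by simp
qed

lemma minimizer_ground_state:
  assumes u: "u \<in> N" and min: "\<And>v. v \<in> N \<Longrightarrow> \<Phi> u \<le> \<Phi> v"
  shows "ereal (\<Phi> u) = nehari_level \<Phi> \<Phi>'" "nontrivial_ground_state \<Phi> \<Phi>' u"
proof -
  show "ereal (\<Phi> u) = nehari_level \<Phi> \<Phi>'"
    unfolding nehari_level_def using u min
    by (intro antisym INF_greatest INF_lower2[OF u]) auto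
  have "v \<in> N" if "v \<noteq> 0" "\<Phi>' v = 0" for v using that by (simp add: nehari_set_def)
  then show "nontrivial_ground_state \<Phi> \<Phi>' u"
    using nehari_minimizer_critical[OF u min] min nehari_nonzero[OF u]
    by (auto simp: nontrivial_ground_state_def)
qed

end

section \<open>Existence of a minimiser\<close>

text \<open>For fixed \<open>t\<close>, the perturbation \<open>I (t v\<^sub>n)\<close> tends to \<open>I 0\<close>, a constant independent of \<open>t\<close>,
  whereas the leading term is at least \<open>C\<^sub>0 * (t * d) powr r\<close>.\<close>

lemma ray_energy_unbounded_if_weakly_null:
  fixes \<Phi> I :: "'a::real_normed_vector \<Rightarrow> real"
  assumes C0: "C\<^sub>0 > 0" and r: "r > 0" and I: "weakly_continuous I"
    and coercive: "\<And>u. \<Phi> u \<ge> C\<^sub>0 * norm u powr r - I u"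
    and v: "weakly_tendsto v 0" and d: "d > 0" "\<And>n. d \<le> norm (v n)"
  shows "\<exists>t>0. \<exists>n. \<Phi> (t *\<^sub>R v n) > B"
proof -
  \<comment> \<open>Solves \<open>C\<^sub>0 * (t * d) powr r \<ge> B + I 0 + 1\<close>; the maximum with \<open>1\<close> keeps \<open>t\<close> positive.\<close>
  define t where "t = (max 1 ((B + I 0 + 1) / C\<^sub>0)) powr (1 / r) / d"
  have t: "t > 0" using d by (simp add: t_def)
  have "(t * d) powr r = max 1 ((B + I 0 + 1) / C\<^sub>0)"
    using d r by (simp add: t_def powr_powr)
  then have big: "C\<^sub>0 * (t * d) powr r \<ge> B + I 0 + 1"
    using C0 by (simp add: field_simps max_def)
  have "(\<lambda>n. I (t *\<^sub>R v n)) \<longlonglongrightarrow> I (t *\<^sub>R 0)"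
    using I weakly_tendsto_scaleR[OF v] unfolding weakly_continuous_def by blast
  then have "\<forall>\<^sub>F n in sequentially. I (t *\<^sub>R v n) < I 0 + 1"
    by (intro order_tendstoD(2)) auto
  then obtain n where n: "I (t *\<^sub>R v n) < I 0 + 1"
    using eventually_happens' sequentially_bot by blast
  have "(t * d) powr r \<le> norm (t *\<^sub>R v n) powr r"
    using t d r by (intro powr_mono2) auto
  then have "C\<^sub>0 * (t * d) powr r \<le> C\<^sub>0 * norm (t *\<^sub>R v n) powr r" using C0 by simp
  then have "\<Phi> (t *\<^sub>R v n) > B" using coercive[of "t *\<^sub>R v n"] big n by simp
  then show ?thesis using t by blast
qed

context nehari_fibering
begin

text \<open>Normalise an unbounded sequence in the sublevel set and pass to a weak limit \<open>v\<close>. If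
  \<open>v = 0\<close>, then the energy along the rays is unbounded, although its maximum on each ray is at
  most \<open>B\<close>. If \<open>v \<noteq> 0\<close>, then the normalised sequence together with \<open>v\<close> is a weakly compact set without
  \<open>0\<close>, and the uniform decay makes \<open>\<Phi>\<close> negative at a Nehari point.\<close>

lemma nehari_sublevel_bounded:
  assumes refl: "reflexive_space TYPE('a)"
    and C0: "C\<^sub>0 > 0" and r: "r > 0" and I: "weakly_continuous I"
    and coercive: "\<And>u. \<Phi> u \<ge> C\<^sub>0 * norm u powr r - I u"
    and far: "\<And>K B. compactin weak_topology K \<Longrightarrow> 0 \<notin> K \<Longrightarrow>
               \<forall>\<^sub>F t in at_top. \<forall>u\<in>K. \<Phi> (t *\<^sub>R u) / t powr p < B"
  shows "\<exists>R. \<forall>u\<in>N. \<Phi> u \<le> B \<longrightarrow> norm u \<le> R"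
proof (rule ccontr)
  assume "\<not> ?thesis"
  then have "\<exists>u\<in>N. \<Phi> u \<le> B \<and> real n < norm u" for n by (auto simp: not_le)
  then obtain x where x: "\<And>n. x n \<in> N" "\<And>n. \<Phi> (x n) \<le> B" "\<And>n. real n < norm (x n)" by metis
  have x0: "norm (x n) > 0" for n using nehari_nonzero[OF x(1)] by simp
  define y where "y n = x n /\<^sub>R norm (x n)" for n
  have y: "norm (y n) = 1" "x n = norm (x n) *\<^sub>R y n" for n using x0[of n] by (auto simp: y_def)
  obtain s v where s: "strict_mono s" and v: "weakly_tendsto (y \<circ> s) v"
    using reflexive_weakly_convergent_subsequence[OF refl, of y 1] y(1) by auto
  show False
  proof (cases "v = 0")
    case True
    obtain t n where t: "t > 0" "\<Phi> (t *\<^sub>R y (s n)) > B"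
      using ray_energy_unbounded_if_weakly_null[OF C0 r I coercive v[unfolded True], of 1 B] y(1)
      by auto
    have "t *\<^sub>R y (s n) = (t / norm (x (s n))) *\<^sub>R x (s n)"
      by (simp add: y_def divide_inverse)
    then have "\<Phi> (t *\<^sub>R y (s n)) \<le> \<Phi> (x (s n))"
      using nehari_max_on_ray[OF x(1), of "t / norm (x (s n))"] t(1) x0 by simp
    then show False using t(2) x(2)[of "s n"] by simp
  next
    case False
    have "compactin weak_topology (insert v (range (y \<circ> s)))"
      by (intro compactin_sequence_with_limit[OF v]) (auto simp: topspace_weak_topology)
    moreover have "0 \<notin> insert v (range (y \<circ> s))"
    proof -
      have "y n \<noteq> 0" for n using y(1)[of n] by auto
      then show ?thesis using False by (metis comp_apply insertE rangeE)
    qed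
    ultimately have ev: "\<forall>\<^sub>F t in at_top. \<forall>u\<in>insert v (range (y \<circ> s)). \<Phi> (t *\<^sub>R u) / t powr p < 0"
      by (rule far)
    then obtain T where T: "\<And>t u. t \<ge> T \<Longrightarrow> u \<in> insert v (range (y \<circ> s)) \<Longrightarrow> \<Phi> (t *\<^sub>R u) / t powr p < 0"
      by (auto simp: eventually_at_top_linorder)
    obtain n where n: "real n \<ge> T" using real_arch_simple by blast
    have "T \<le> norm (x (s n))"
      using n x(3)[of "s n"] seq_suble[OF s, of n] by linarith
    then have "\<Phi> (norm (x (s n)) *\<^sub>R y (s n)) / norm (x (s n)) powr p < 0" by (intro T) auto
    then have "\<Phi> (x (s n)) < 0" unfolding y(2)[symmetric] by (simp add: divide_less_0_iff)
    then show False using nehari_pos[OF x(1), of "s n"] by simp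
  qed
qed

text \<open>The weak limit \<open>w\<close> of a minimising sequence is nonzero, but may lie off the Nehari
  set. Its projection \<open>t w\<close> along the ray has \<open>t \<le> 1\<close> because \<open>\<Phi>' w w \<le> 0\<close>. The functional
  \<open>\<Psi> u = \<Phi> u - \<Phi>' u u / p\<close> coincides with \<open>\<Phi>\<close> on the Nehari set, increases along rays and is weakly lower
  semicontinuous; so the projection does not raise the energy above the infimum.\<close>

lemma nehari_minimum_attained:
  assumes nontrivial: "\<exists>x::'a. x \<noteq> 0"
    and refl: "reflexive_space TYPE('a)"
    and C0: "C\<^sub>0 > 0" and r: "r > 0" and I: "weakly_continuous I"
    and coercive: "\<And>u. \<Phi> u \<ge> C\<^sub>0 * norm u powr r - I u"
    and far: "\<And>K B. compactin weak_topology K \<Longrightarrow> 0 \<notin> K \<Longrightarrow>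
               \<forall>\<^sub>F t in at_top. \<forall>u\<in>K. \<Phi> (t *\<^sub>R u) / t powr p < B"
    and increasing: "\<And>u. u \<noteq> 0 \<Longrightarrow>
               strict_mono_on {0<..} (\<lambda>t. \<Phi> (t *\<^sub>R u) - 1 / p * \<Phi>' (t *\<^sub>R u) (t *\<^sub>R u))"
    and lsc: "weakly_lsc (\<lambda>u. \<Phi>' u u)" "weakly_lsc (\<lambda>u. \<Phi> u - 1 / p * \<Phi>' u u)"
  obtains u where "u \<in> N" "\<And>v. v \<in> N \<Longrightarrow> \<Phi> u \<le> \<Phi> v"
proof -
  define c where "c = Inf (\<Phi> ` N)"
  have ne: "\<Phi> ` N \<noteq> {}" using nontrivial ray_meets_nehari by blast
  have bdd: "bdd_below (\<Phi> ` N)"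
    using nehari_pos by (intro bdd_belowI2[where m = 0]) (auto intro: less_imp_le)
  have c_le: "c \<le> \<Phi> v" if "v \<in> N" for v unfolding c_def using bdd that by (intro cInf_lower) auto
  have "\<exists>u\<in>N. \<Phi> u < c + 1 / Suc n" for n
    using cInf_lessD[OF ne, of "c + 1 / Suc n"] by (auto simp: c_def)
  then obtain x where x: "\<And>n. x n \<in> N" "\<And>n. \<Phi> (x n) < c + 1 / Suc n" by metis
  have lim: "(\<lambda>n. \<Phi> (x n)) \<longlonglongrightarrow> c"
  proof (rule tendsto_sandwich[OF _ _ tendsto_const])
    show "(\<lambda>n. c + 1 / Suc n) \<longlonglongrightarrow> c"
      using tendsto_add[OF tendsto_const LIMSEQ_inverse_real_of_nat, of c]
      by (simp add: inverse_eq_divide)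
    show "\<forall>\<^sub>F n in sequentially. c \<le> \<Phi> (x n)" using c_le x(1) by simp
    show "\<forall>\<^sub>F n in sequentially. \<Phi> (x n) \<le> c + 1 / Suc n"
      using x(2) by (intro always_eventually allI less_imp_le)
  qed
  have le1: "\<Phi> (x n) \<le> c + 1" for n
  proof -
    have "1 / real (Suc n) \<le> 1" by simp
    then show ?thesis using x(2)[of n] by linarith
  qed
  obtain R where "\<And>u. u \<in> N \<Longrightarrow> \<Phi> u \<le> c + 1 \<Longrightarrow> norm u \<le> R"
    using nehari_sublevel_bounded[OF refl C0 r I coercive far] by blast
  then have "norm (x n) \<le> R" for n using x(1) le1 by blast
  then obtain s w where s: "strict_mono s" and w: "weakly_tendsto (x \<circ> s) w"
    using reflexive_weakly_convergent_subsequence[OF refl] by blast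
  have "w \<noteq> 0"
  proof
    assume w0: "w = 0"
    obtain t n where t: "t > 0" "\<Phi> (t *\<^sub>R x (s n)) > c + 1"
      using ray_energy_unbounded_if_weakly_null[OF C0 r I coercive w[unfolded w0] radius_pos, of "c + 1"]
        nehari_norm_ge[OF x(1)] by auto
    then show False using nehari_max_on_ray[OF x(1) t(1), of "s n"] le1[of "s n"] by simp
  qed
  then obtain t where t: "t > 0" "t *\<^sub>R w \<in> N" using ray_meets_nehari by blast
  have "ereal (\<Phi>' w w) \<le> liminf (\<lambda>n. ereal (\<Phi>' ((x \<circ> s) n) ((x \<circ> s) n)))"
    using lsc(1) w unfolding weakly_lsc_def by blast
  then have w_le: "\<Phi>' w w \<le> 0"
    by (simp add: nehari_derivative[OF x(1)] Liminf_const zero_ereal_def)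
  have "t \<le> 1"
  proof (rule ccontr)
    assume "\<not> t \<le> 1"
    then have "\<Phi>' (inverse t *\<^sub>R (t *\<^sub>R w)) (t *\<^sub>R w) > 0"
      by (intro derivative_pos_before[OF t(2)]) (auto simp: field_simps)
    then show False using w_le t(1) by (simp add: blinfun.scaleR_right zero_less_mult_iff)
  qed
  define \<Psi> where "\<Psi> u = \<Phi> u - 1 / p * \<Phi>' u u" for u
  have "\<Psi> (t *\<^sub>R w) \<le> \<Psi> (1 *\<^sub>R w)"
    unfolding \<Psi>_def using strict_mono_on_leD[OF increasing[OF \<open>w \<noteq> 0\<close>], of t 1] t(1) \<open>t \<le> 1\<close> by simp
  moreover have "ereal (\<Psi> w) \<le> liminf (\<lambda>n. ereal (\<Psi> ((x \<circ> s) n)))"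
    using lsc(2) w unfolding weakly_lsc_def \<Psi>_def by blast
  moreover have "liminf (\<lambda>n. ereal (\<Psi> ((x \<circ> s) n))) = ereal c"
  proof -
    have eq: "(\<lambda>n. \<Psi> ((x \<circ> s) n)) = (\<lambda>n. \<Phi> (x n)) \<circ> s"
      by (auto simp: \<Psi>_def nehari_derivative[OF x(1)])
    have "(\<lambda>n. \<Psi> ((x \<circ> s) n)) \<longlonglongrightarrow> c" unfolding eq by (rule LIMSEQ_subseq_LIMSEQ[OF lim s])
    then have "(\<lambda>n. ereal (\<Psi> ((x \<circ> s) n))) \<longlonglongrightarrow> ereal c" by (rule tendsto_ereal)
    then show ?thesis by (intro lim_imp_Liminf) auto
  qed
  ultimately have "\<Psi> (t *\<^sub>R w) \<le> c" by simp
  then have "\<Phi> (t *\<^sub>R w) \<le> c" by (simp add: \<Psi>_def nehari_derivative[OF t(2)])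
  then show ?thesis using that[OF t(2)] c_le order_trans by blast
qed

text \<open>The modulus \<open>w\<close> of a minimiser \<open>u\<close> need not lie in the Nehari set. Project it to \<open>t w\<close>: this
  is the modulus of \<open>t u\<close>, whose energy is at most that of \<open>u\<close> as \<open>u\<close> maximises \<open>\<Phi>\<close> on its ray.\<close>

lemma nonnegative_nehari_minimizer:
  assumes u: "u \<in> N" and min: "\<And>v. v \<in> N \<Longrightarrow> \<Phi> u \<le> \<Phi> v"
    and rep: "function_space M rep" and modulus: "modulus_decreasing M rep \<Phi>"
  obtains z where "z \<in> N" "\<And>v. v \<in> N \<Longrightarrow> \<Phi> z \<le> \<Phi> v" "AE x in M. 0 \<le> rep z x"
proof -
  have add: "\<And>u v. AE x in M. rep (u + v) x = rep u x + rep v x"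
    and scale: "\<And>a u. AE x in M. rep (a *\<^sub>R u) x = a * rep u x"
    and null: "\<And>u. AE x in M. rep u x = 0 \<Longrightarrow> u = 0"
    using rep unfolding function_space_def by blast+
  obtain w where w: "AE x in M. rep w x = \<bar>rep u x\<bar>"
    using modulus unfolding modulus_decreasing_def by blast
  have "w \<noteq> 0"
  proof
    assume "w = 0"
    have "AE x in M. rep u x = 0"
      using w scale[of 0 w] by eventually_elim (simp add: \<open>w = 0\<close>)
    then show False using null nehari_nonzero[OF u] by blast
  qed
  then obtain t where t: "t > 0" "t *\<^sub>R w \<in> N" using ray_meets_nehari by blast
  obtain z where z: "AE x in M. rep z x = \<bar>rep (t *\<^sub>R u) x\<bar>" "\<Phi> z \<le> \<Phi> (t *\<^sub>R u)"
    using modulus unfolding modulus_decreasing_def by blast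
  have "AE x in M. rep (z + (- t) *\<^sub>R w) x = 0"
    using z(1) w scale[of t u] scale[of "- t" w] add[of z "(- t) *\<^sub>R w"]
    by eventually_elim (use t(1) in \<open>simp add: abs_mult\<close>)
  then have zw: "z = t *\<^sub>R w" using null[of "z + (- t) *\<^sub>R w"] by simp
  have "AE x in M. 0 \<le> rep z x" using z(1) by eventually_elim simp
  moreover have "\<Phi> z \<le> \<Phi> v" if "v \<in> N" for v
    using z(2) nehari_max_on_ray[OF u t(1)] min[OF that] by linarith
  ultimately show ?thesis using that[of z] t(2) zw by blast
qed

end

theorem theorem1p2:
  fixes \<Phi> :: "'a::banach \<Rightarrow> real"
    and \<Phi>' :: "'a \<Rightarrow> 'a \<Rightarrow>\<^sub>L real"
    and I :: "'a \<Rightarrow> real"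
    and p r C\<^sub>0 :: real
    and M :: "'b measure"
    and rep :: "'a \<Rightarrow> 'b \<Rightarrow> real"
  assumes nontrivial: "\<exists>x::'a. x \<noteq> 0"
    and reflexive: "reflexive_space TYPE('a)"
    and norm_C1: "\<exists>N'. C1_on (- {0}) (norm :: 'a \<Rightarrow> real) N'"
    and Phi_C1: "C1_on UNIV \<Phi> \<Phi>'"
    and Phi_0: "\<Phi> 0 = 0"
    and p: "p > 1" and r: "r > 1"
    and H1: "Liminf (at 0) (\<lambda>u. ereal (\<Phi>' u u / norm u powr r)) > 0"
    and H2: "C\<^sub>0 > 0" "weakly_continuous I" "\<And>u. \<Phi> u \<ge> C\<^sub>0 * norm u powr r - I u"
    and H3: "\<And>K B. compactin weak_topology K \<Longrightarrow> 0 \<notin> K \<Longrightarrow>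
               \<forall>\<^sub>F t in at_top. \<forall>u\<in>K. \<Phi> (t *\<^sub>R u) / t powr p < B"
    and H4: "\<And>u. u \<noteq> 0 \<Longrightarrow> strict_antimono_on {0<..} (\<lambda>t. \<Phi>' (t *\<^sub>R u) u / t powr (p - 1))"
            "\<And>u. u \<noteq> 0 \<Longrightarrow>
               strict_mono_on {0<..} (\<lambda>t. \<Phi> (t *\<^sub>R u) - 1 / p * \<Phi>' (t *\<^sub>R u) (t *\<^sub>R u))"
    and H5: "weakly_lsc (\<lambda>u. \<Phi>' u u)" "weakly_lsc (\<lambda>u. \<Phi> u - 1 / p * \<Phi>' u u)"
  shows "0 < nehari_level \<Phi> \<Phi>' \<and>
    (\<exists>u\<^sub>0\<in>nehari_set \<Phi>'. ereal (\<Phi> u\<^sub>0) = nehari_level \<Phi> \<Phi>' \<and>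
        nontrivial_ground_state \<Phi> \<Phi>' u\<^sub>0) \<and>
    ((\<forall>u. \<Phi> (- u) = \<Phi> u) \<and> function_space M rep \<and> modulus_decreasing M rep \<Phi> \<longrightarrow>
      (\<exists>u\<^sub>0\<in>nehari_set \<Phi>'. ereal (\<Phi> u\<^sub>0) = nehari_level \<Phi> \<Phi>' \<and>
          nontrivial_ground_state \<Phi> \<Phi>' u\<^sub>0 \<and> (AE x in M. 0 \<le> rep u\<^sub>0 x)))"
proof -
  obtain \<delta> where \<delta>: "\<delta> > 0" "\<And>u. u \<noteq> 0 \<Longrightarrow> norm u < \<delta> \<Longrightarrow> \<Phi>' u u > 0"
    using Liminf_pos_imp_pos_near[OF H1] by blast
  have far: "\<exists>t>0. \<Phi> (t *\<^sub>R u) \<le> 0" if "u \<noteq> 0" for u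
  proof -
    \<comment> \<open>The uniform decay on weakly compact sets, for a single point.\<close>
    have "compactin weak_topology {u}" by (simp add: topspace_weak_topology)
    then have "\<forall>\<^sub>F t in at_top. \<forall>v\<in>{u}. \<Phi> (t *\<^sub>R v) / t powr p < 0"
      by (rule H3) (use that in simp)
    then have "\<forall>\<^sub>F t in at_top. t > 0 \<and> \<Phi> (t *\<^sub>R u) \<le> 0"
      using eventually_gt_at_top[of 0] by eventually_elim (simp add: divide_less_0_iff)
    then show ?thesis using eventually_happens'[OF trivial_limit_at_top_linorder] by blast
  qed
  interpret nehari_fibering \<Phi> \<Phi>' p \<delta>
    by unfold_locales (fact Phi_C1 Phi_0 \<delta> far H4(1))+
  have r0: "r > 0" using r by simp
  obtain u where u: "u \<in> N" "\<And>v. v \<in> N \<Longrightarrow> \<Phi> u \<le> \<Phi> v"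
    using nehari_minimum_attained[OF nontrivial reflexive H2(1) r0 H2(2,3) H3 H4(2) H5] by blast
  have "0 < nehari_level \<Phi> \<Phi>'"
    using nehari_pos[OF u(1)] by (simp flip: minimizer_ground_state(1)[OF u])
  moreover have "\<exists>z\<in>N. ereal (\<Phi> z) = nehari_level \<Phi> \<Phi>' \<and>
      nontrivial_ground_state \<Phi> \<Phi>' z \<and> (AE x in M. 0 \<le> rep z x)"
    if rep: "function_space M rep" "modulus_decreasing M rep \<Phi>"
  proof -
    obtain z where "z \<in> N" "\<And>v. v \<in> N \<Longrightarrow> \<Phi> z \<le> \<Phi> v" "AE x in M. 0 \<le> rep z x"
      using nonnegative_nehari_minimizer[OF u rep] by blast
    then show ?thesis using minimizer_ground_state by blast
  qed
  ultimately show ?thesis using u minimizer_ground_state[OF u] by blast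
qed

end
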